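(* Let $X,Y$ be Banach spaces, $1\le p\le\infty$, and $T\in K_p^d(X,Y)$. Then for every $\varepsilon>0$ and every Banach space $Z\supseteq X$ there exists an extension $\widetilde T\in K_p^d(Z,\ell_\infty(B_{Y^*}))$ of $T$ (that is, $\widetilde T|_X=i_Y\circ T$, where $i_Y:Y\to\ell_\infty(B_{Y^*})$ is the canonical isometric embedding $y\mapsto(y^*(y))_{y^*\in B_{Y^*}}$) such that $\kappa_p^d(\widetilde T)\le\kappa_p^d(T)+\varepsilon$.
   Context: Banach spaces are over the complex scalars; $B(X,Y)$ is the space of bounded linear operators and $B_X$ the closed unit ball. $\ell_\infty(B_{Y^*})$ is the space of bounded scalar functions on $B_{Y^*}$ with supremum norm. For $1\le p\le\infty$ let $\frac1p+\frac1q=1$, with $c_0$ used in place of $\ell_q$ when $p=1$. For $p<\infty$, $\ell_p^s(V)$ is the space of sequences $(v_n)$ in $V$ with $\|(v_n)\|_p^s=(\sum_n\|v_n\|^p)^{1/p}<\infty$; for $p=\infty$ it is replaced by $c_0^s(V)$, the norm-null sequences with supremum norm. $E_v:\ell_q\to V$ is $E_v((\alpha_n))=\sum_n\alpha_nv_n$. $S\in B(U,V)$ is $p$-compact, $S\in K_p(U,V)$, if $S(B_U)\subseteq E_v(B_{\ell_q})$ for some such $v$, and $\kappa_p(S)$ is the infimum of the norms of all such $v$ (so $K_\infty$ is the compact operators with the operator norm). $K_p^d(U,V)=\{S\in B(U,V):S^*\in K_p(V^*,U^* )\}$, $\kappa_p^d(S)=\kappa_p(S^* )$. *)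

theory Defs
  imports "HOL-Analysis.Analysis" "HOL-Probability.Discrete_Topology"
begin

section \<open>Complex Banach spaces\<close>

text \<open>
  The library's normed spaces are real.  A complex normed space is a real one with a complex
  scalar multiplication extending the real one, for which the norm is absolutely homogeneous.
\<close>

class complex_normed_vector = real_normed_vector +
  fixes scaleC :: "complex \<Rightarrow> 'a \<Rightarrow> 'a" (infixr \<open>*\<^sub>C\<close> 75)
  assumes scaleC_add_right: "c *\<^sub>C (x + y) = c *\<^sub>C x + c *\<^sub>C y"
    and scaleC_add_left: "(c + d) *\<^sub>C x = c *\<^sub>C x + d *\<^sub>C x"
    and scaleC_scaleC: "c *\<^sub>C (d *\<^sub>C x) = (c * d) *\<^sub>C x"
    and scaleC_of_real: "complex_of_real r *\<^sub>C x = r *\<^sub>R x"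
    and norm_scaleC: "norm (c *\<^sub>C x) = cmod c * norm x"

class complex_banach = complex_normed_vector + banach

instantiation complex :: complex_banach
begin

definition scaleC_complex :: "complex \<Rightarrow> complex \<Rightarrow> complex"
  where "scaleC_complex = (*)"

instance
  by standard (auto simp: scaleC_complex_def algebra_simps norm_mult scaleR_conv_of_real)

end

lemma scaleC_diff_right: "c *\<^sub>C (x - y) = c *\<^sub>C x - c *\<^sub>C (y :: 'a :: complex_normed_vector)"
  by (metis add_diff_cancel_right' diff_add_cancel scaleC_add_right)

lemma scaleC_scaleR: "c *\<^sub>C (r *\<^sub>R x) = r *\<^sub>R (c *\<^sub>C (x :: 'a :: complex_normed_vector))"
  by (metis mult.commute scaleC_of_real scaleC_scaleC)

lemma bounded_linear_scaleC: "bounded_linear (\<lambda>x :: 'a :: complex_normed_vector. c *\<^sub>C x)"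
  by (rule bounded_linear_intro[where K = "cmod c"])
    (auto simp: scaleC_add_right scaleC_scaleR norm_scaleC)

section \<open>Bounded complex-linear operators\<close>

definition bounded_clinear ::
    "('a :: complex_normed_vector \<Rightarrow> 'b :: complex_normed_vector) \<Rightarrow> bool"
  where "bounded_clinear f \<longleftrightarrow> bounded_linear f \<and> (\<forall>c x. f (c *\<^sub>C x) = c *\<^sub>C f x)"

lemma bounded_clinear_zero: "bounded_clinear (\<lambda>_. 0)"
  using scaleC_scaleR[of _ 0 0] by (auto simp: bounded_clinear_def)

lemma bounded_clinear_add:
  "bounded_clinear f \<Longrightarrow> bounded_clinear g \<Longrightarrow> bounded_clinear (\<lambda>x. f x + g x)"
  by (auto simp: bounded_clinear_def scaleC_add_right intro: bounded_linear_add)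

lemma bounded_clinear_diff:
  "bounded_clinear f \<Longrightarrow> bounded_clinear g \<Longrightarrow> bounded_clinear (\<lambda>x. f x - g x)"
  by (auto simp: bounded_clinear_def scaleC_diff_right intro: bounded_linear_sub)

lemma bounded_clinear_minus:
  "bounded_clinear f \<Longrightarrow> bounded_clinear (\<lambda>x. - f x)"
  using bounded_clinear_diff[OF bounded_clinear_zero] by simp

lemma bounded_clinear_scaleC:
  "bounded_clinear f \<Longrightarrow> bounded_clinear (\<lambda>x. c *\<^sub>C f x)"
  by (auto simp: bounded_clinear_def scaleC_scaleC mult.commute
      intro: bounded_linear_compose[OF bounded_linear_scaleC])

lemma bounded_clinear_scaleR:
  "bounded_clinear f \<Longrightarrow> bounded_clinear (\<lambda>x. r *\<^sub>R f x)"
  using bounded_clinear_scaleC[of f "complex_of_real r"] by (simp add: scaleC_of_real)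

lemma bounded_clinear_compose:
  "bounded_clinear f \<Longrightarrow> bounded_clinear g \<Longrightarrow> bounded_clinear (\<lambda>x. f (g x))"
  by (auto simp: bounded_clinear_def intro: bounded_linear_compose)

typedef (overloaded) ('a, 'b) cblinfun (\<open>(_ \<Rightarrow>\<^sub>B /_)\<close> [22, 21] 21) =
  "{f :: 'a :: complex_normed_vector \<Rightarrow> 'b :: complex_normed_vector. bounded_clinear f}"
  morphisms cblinfun_apply CBlinfun
  using bounded_clinear_zero by blast

declare [[coercion "cblinfun_apply ::
  ('a :: complex_normed_vector \<Rightarrow>\<^sub>B 'b :: complex_normed_vector) \<Rightarrow> 'a \<Rightarrow> 'b"]]

setup_lifting type_definition_cblinfun

lemma bounded_clinear_apply: "bounded_clinear (cblinfun_apply f)"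
  using cblinfun_apply by blast

lemma bounded_linear_apply: "bounded_linear (cblinfun_apply f)"
  using bounded_clinear_apply bounded_clinear_def by blast

lemma cblinfun_eqI: "(\<And>x. cblinfun_apply f x = cblinfun_apply g x) \<Longrightarrow> f = g"
  by transfer auto

instantiation cblinfun :: (complex_normed_vector, complex_normed_vector) complex_normed_vector
begin

lift_definition norm_cblinfun :: "'a \<Rightarrow>\<^sub>B 'b \<Rightarrow> real" is onorm .

lift_definition minus_cblinfun :: "'a \<Rightarrow>\<^sub>B 'b \<Rightarrow> 'a \<Rightarrow>\<^sub>B 'b \<Rightarrow> 'a \<Rightarrow>\<^sub>B 'b"
  is "\<lambda>f g x. f x - g x"
  by (rule bounded_clinear_diff)

definition dist_cblinfun :: "'a \<Rightarrow>\<^sub>B 'b \<Rightarrow> 'a \<Rightarrow>\<^sub>B 'b \<Rightarrow> real"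
  where "dist_cblinfun f g = norm (f - g)"

definition uniformity_cblinfun :: "(('a \<Rightarrow>\<^sub>B 'b) \<times> ('a \<Rightarrow>\<^sub>B 'b)) filter"
  where "uniformity_cblinfun = (INF e\<in>{0 <..}. principal {(x, y). dist x y < e})"

definition open_cblinfun :: "('a \<Rightarrow>\<^sub>B 'b) set \<Rightarrow> bool"
  where "open_cblinfun S = (\<forall>x\<in>S. \<forall>\<^sub>F (x', y) in uniformity. x' = x \<longrightarrow> y \<in> S)"

lift_definition uminus_cblinfun :: "'a \<Rightarrow>\<^sub>B 'b \<Rightarrow> 'a \<Rightarrow>\<^sub>B 'b" is "\<lambda>f x. - f x"
  by (rule bounded_clinear_minus)

lift_definition zero_cblinfun :: "'a \<Rightarrow>\<^sub>B 'b" is "\<lambda>_. 0"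
  by (rule bounded_clinear_zero)

lift_definition plus_cblinfun :: "'a \<Rightarrow>\<^sub>B 'b \<Rightarrow> 'a \<Rightarrow>\<^sub>B 'b \<Rightarrow> 'a \<Rightarrow>\<^sub>B 'b"
  is "\<lambda>f g x. f x + g x"
  by (rule bounded_clinear_add)

lift_definition scaleR_cblinfun :: "real \<Rightarrow> 'a \<Rightarrow>\<^sub>B 'b \<Rightarrow> 'a \<Rightarrow>\<^sub>B 'b" is "\<lambda>r f x. r *\<^sub>R f x"
  by (rule bounded_clinear_scaleR)

lift_definition scaleC_cblinfun :: "complex \<Rightarrow> 'a \<Rightarrow>\<^sub>B 'b \<Rightarrow> 'a \<Rightarrow>\<^sub>B 'b" is "\<lambda>c f x. c *\<^sub>C f x"
  by (rule bounded_clinear_scaleC)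

definition sgn_cblinfun :: "'a \<Rightarrow>\<^sub>B 'b \<Rightarrow> 'a \<Rightarrow>\<^sub>B 'b"
  where "sgn_cblinfun f = inverse (norm f) *\<^sub>R f"

instance
proof
  fix f g h :: "'a \<Rightarrow>\<^sub>B 'b" and r s :: real and c d :: complex
  show "dist f g = norm (f - g)" by (rule dist_cblinfun_def)
  show "sgn f = inverse (norm f) *\<^sub>R f" by (rule sgn_cblinfun_def)
  show "uniformity = (INF e\<in>{0 <..}. principal {(x :: 'a \<Rightarrow>\<^sub>B 'b, y). dist x y < e})"
    by (rule uniformity_cblinfun_def)
  show "open U = (\<forall>x\<in>U. \<forall>\<^sub>F (x', y) in uniformity. x' = x \<longrightarrow> y \<in> U)" for U :: "('a \<Rightarrow>\<^sub>B 'b) set"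
    by (rule open_cblinfun_def)
  show "norm f = 0 \<longleftrightarrow> f = 0"
    by transfer (auto simp: bounded_clinear_def onorm_eq_0)
  show "norm (f + g) \<le> norm f + norm g"
    by transfer (auto simp: bounded_clinear_def onorm_triangle)
  show "norm (r *\<^sub>R f) = \<bar>r\<bar> * norm f"
    by transfer (auto simp: bounded_clinear_def onorm_scaleR)
  show "norm (c *\<^sub>C f) = cmod c * norm f"
  proof transfer
    fix c :: complex and f :: "'a \<Rightarrow> 'b"
    assume "bounded_clinear f"
    then have f: "bounded_linear f" by (simp add: bounded_clinear_def)
    have "onorm (\<lambda>x. c *\<^sub>C f x) = onorm (\<lambda>x. cmod c *\<^sub>R f x)"
      by (simp add: onorm_def norm_scaleC)
    then show "onorm (\<lambda>x. c *\<^sub>C f x) = cmod c * onorm f"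
      using onorm_scaleR[OF f, of "cmod c"] by simp
  qed
qed (transfer; force simp: algebra_simps scaleC_add_right scaleC_add_left scaleC_scaleC
      scaleC_of_real)+

end

lemma norm_cblinfun: "norm (cblinfun_apply f x) \<le> norm f * norm x"
  by transfer (simp add: bounded_clinear_def onorm)

instance cblinfun :: (complex_normed_vector, complex_banach) complex_banach
proof
  fix X :: "nat \<Rightarrow> 'a \<Rightarrow>\<^sub>B 'b"
  assume X: "Cauchy X"
  define B where "B f = Blinfun (cblinfun_apply f)" for f :: "'a \<Rightarrow>\<^sub>B 'b"
  have B: "blinfun_apply (B f) = cblinfun_apply f" for f
    unfolding B_def by (rule bounded_linear_Blinfun_apply[OF bounded_linear_apply])
  have norm_B: "norm f = norm (B f)" for f
    by (simp add: norm_blinfun.rep_eq norm_cblinfun.rep_eq B)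
  have B_diff: "B f - B g = B (f - g)" for f g
    by (rule blinfun_eqI) (simp add: B blinfun.diff_left minus_cblinfun.rep_eq)
  have "Cauchy (\<lambda>n. B (X n))"
    using X by (simp add: Cauchy_def dist_norm B_diff norm_B[symmetric])
  then obtain L where L: "(\<lambda>n. B (X n)) \<longlonglongrightarrow> L"
    using Cauchy_convergent_iff convergent_def by blast
  have lim: "(\<lambda>n. cblinfun_apply (X n) x) \<longlonglongrightarrow> blinfun_apply L x" for x
    using blinfun.tendsto[OF L tendsto_const[of x]] by (simp add: B)
  have "blinfun_apply L (c *\<^sub>C x) = c *\<^sub>C blinfun_apply L x" for c x
  proof (rule LIMSEQ_unique[OF lim])
    have "cblinfun_apply (X n) (c *\<^sub>C x) = c *\<^sub>C cblinfun_apply (X n) x" for n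
      using bounded_clinear_apply by (auto simp: bounded_clinear_def)
    then show "(\<lambda>n. cblinfun_apply (X n) (c *\<^sub>C x)) \<longlonglongrightarrow> c *\<^sub>C blinfun_apply L x"
      using bounded_linear.tendsto[OF bounded_linear_scaleC lim] by simp
  qed
  then have "bounded_clinear (blinfun_apply L)"
    by (simp add: bounded_clinear_def blinfun.bounded_linear_right)
  then obtain M where M: "cblinfun_apply M = blinfun_apply L"
    using CBlinfun_inverse by blast
  have "B M = L" by (rule blinfun_eqI) (simp add: B M)
  then have "X \<longlonglongrightarrow> M"
    using L by (simp add: LIMSEQ_iff B_diff[symmetric] norm_B)
  then show "convergent X" by (auto simp: convergent_def)
qed

lemma norm_cblinfun_bound:
  "0 \<le> b \<Longrightarrow> (\<And>x. norm (cblinfun_apply f x) \<le> b * norm x) \<Longrightarrow> norm f \<le> b"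
  by transfer (rule onorm_bound)

lift_definition cblinfun_compose ::
    "('b :: complex_normed_vector \<Rightarrow>\<^sub>B 'c :: complex_normed_vector) \<Rightarrow>
     ('a :: complex_normed_vector \<Rightarrow>\<^sub>B 'b) \<Rightarrow> 'a \<Rightarrow>\<^sub>B 'c"
  is "\<lambda>f g x. f (g x)"
  by (rule bounded_clinear_compose)

lemma norm_cblinfun_compose: "norm (cblinfun_compose f g) \<le> norm f * norm g"
proof (rule norm_cblinfun_bound)
  fix x
  have "norm (f (g x)) \<le> norm f * norm (g x)" by (rule norm_cblinfun)
  also have "\<dots> \<le> norm f * (norm g * norm x)" by (intro mult_left_mono norm_cblinfun norm_ge_zero)
  finally show "norm (cblinfun_compose f g x) \<le> norm f * norm g * norm x"
    by (simp add: cblinfun_compose.rep_eq mult.assoc)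
qed simp

type_synonym 'a cdual = "'a \<Rightarrow>\<^sub>B complex"

text \<open>The Banach space adjoint, which is complex-linear (no conjugation).\<close>

lift_definition adjoint ::
    "('a :: complex_normed_vector \<Rightarrow>\<^sub>B 'b :: complex_normed_vector) \<Rightarrow> 'b cdual \<Rightarrow>\<^sub>B 'a cdual"
  is "\<lambda>T \<phi>. cblinfun_compose \<phi> T"
  unfolding bounded_clinear_def
proof (intro conjI allI)
  fix T :: "'a \<Rightarrow>\<^sub>B 'b"
  show "bounded_linear (\<lambda>\<phi> :: 'b cdual. cblinfun_compose \<phi> T)"
    by (rule bounded_linear_intro[where K = "norm T"])
      (auto intro!: cblinfun_eqI norm_cblinfun_compose
        simp: cblinfun_compose.rep_eq plus_cblinfun.rep_eq scaleR_cblinfun.rep_eq)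
  show "cblinfun_compose (c *\<^sub>C \<phi>) T = c *\<^sub>C cblinfun_compose \<phi> T" for c and \<phi> :: "'b cdual"
    by (rule cblinfun_eqI) (simp add: cblinfun_compose.rep_eq scaleC_cblinfun.rep_eq)
qed

lemma adjoint_apply: "adjoint T \<phi> x = \<phi> (T x)"
  by (simp add: adjoint.rep_eq cblinfun_compose.rep_eq)

section \<open>The space of bounded functions on the dual ball\<close>

typedef (overloaded) 'a dual_ball = "{\<phi> :: ('a :: complex_normed_vector) cdual. norm \<phi> \<le> 1}"
  morphisms dual_ball_functional Dual_ball
  by (rule exI[of _ 0]) simp

instantiation bcontfun :: (topological_space, complex_normed_vector) complex_normed_vector
begin

definition scaleC_bcontfun :: "complex \<Rightarrow> ('a \<Rightarrow>\<^sub>C 'b) \<Rightarrow> 'a \<Rightarrow>\<^sub>C 'b"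
  where "scaleC_bcontfun c f = Bcontfun (\<lambda>x. c *\<^sub>C f x)"

lemma apply_scaleC_bcontfun [simp]: "apply_bcontfun (c *\<^sub>C f) x = c *\<^sub>C f x"
  for f :: "'a \<Rightarrow>\<^sub>C 'b"
proof -
  have "bounded (range (\<lambda>x. c *\<^sub>C f x))"
    using bounded_linear_image[OF bounded_apply_bcontfun[of f] bounded_linear_scaleC[of c]]
    by (simp add: image_image)
  moreover have "continuous_on UNIV (\<lambda>x. c *\<^sub>C f x)"
    by (rule bounded_linear.continuous_on[OF bounded_linear_scaleC]) simp
  ultimately show ?thesis
    by (simp add: scaleC_bcontfun_def Bcontfun_inverse bcontfun_def)
qed

instance
proof
  fix f g :: "'a \<Rightarrow>\<^sub>C 'b" and c d :: complex and r :: real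
  show "norm (c *\<^sub>C f) = cmod c * norm f"
  proof (rule antisym)
    have le: "norm (e *\<^sub>C h) \<le> cmod e * norm h" for e and h :: "'a \<Rightarrow>\<^sub>C 'b"
      by (rule norm_bound) (simp add: norm_scaleC norm_bounded mult_left_mono)
    show "norm (c *\<^sub>C f) \<le> cmod c * norm f" by (rule le)
    show "cmod c * norm f \<le> norm (c *\<^sub>C f)"
    proof (cases "c = 0")
      case False
      have "inverse c *\<^sub>C c *\<^sub>C f = f"
        using False scaleC_of_real[of 1]
        by (intro bcontfun_eqI) (simp add: scaleC_scaleC)
      then show ?thesis
        using le[of "inverse c" "c *\<^sub>C f"] False
        by (simp add: norm_divide field_simps)
    qed simp
  qed
qed (auto intro!: bcontfun_eqI
    simp: scaleC_add_right scaleC_add_left scaleC_scaleC scaleC_of_real)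

end

instance bcontfun :: (metric_space, complex_banach) complex_banach ..

text \<open>
  Every function on a discrete space is continuous, so bounded continuous functions on the
  discrete copy of the dual ball are all bounded functions on it, with the supremum norm.
\<close>

type_synonym 'a dual_ball_linf = "'a dual_ball discrete \<Rightarrow>\<^sub>C complex"

definition canonical_embedding :: "'a :: complex_normed_vector \<Rightarrow> 'a dual_ball_linf"
  where "canonical_embedding y = Bcontfun (\<lambda>\<phi>. dual_ball_functional (of_discrete \<phi>) y)"

lemma apply_canonical_embedding:
  "apply_bcontfun (canonical_embedding y) \<phi> = dual_ball_functional (of_discrete \<phi>) y"
proof -
  have "norm (dual_ball_functional (of_discrete \<psi>) y) \<le> 1 * norm y" for \<psi>
    using dual_ball_functional[of "of_discrete \<psi>"]
    by (intro order_trans[OF norm_cblinfun] mult_right_mono) auto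
  then have "(\<lambda>\<psi>. dual_ball_functional (of_discrete \<psi>) y) \<in> bcontfun"
    by (intro bcontfun_normI[where b = "norm y"])
      (auto simp: continuous_on_open_vimage open_discrete)
  then show ?thesis
    by (simp add: canonical_embedding_def Bcontfun_inverse)
qed

section \<open>Operators that are p-compact\<close>

text \<open>Strongly p-summable sequences, with null sequences in place of bounded ones for infinite p.\<close>

definition lp_seqs :: "ereal \<Rightarrow> (nat \<Rightarrow> 'v :: complex_normed_vector) set"
  where "lp_seqs p =
    (if p = \<infinity> then {v. v \<longlonglongrightarrow> 0}
     else {v. summable (\<lambda>n. norm (v n) powr real_of_ereal p)})"

definition lp_norm :: "ereal \<Rightarrow> (nat \<Rightarrow> 'v :: complex_normed_vector) \<Rightarrow> real"
  where "lp_norm p v =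
    (if p = \<infinity> then (SUP n. norm (v n))
     else (\<Sum>n. norm (v n) powr real_of_ereal p) powr (1 / real_of_ereal p))"

definition conjugate_exponent :: "ereal \<Rightarrow> ereal"
  where "conjugate_exponent p =
    (if p = 1 then \<infinity> else if p = \<infinity> then 1 else p / (p - 1))"

lemma conjugate_exponent:
  assumes "1 \<le> p"
  shows "1 \<le> conjugate_exponent p" "1 / p + 1 / conjugate_exponent p = 1"
  using assms
  by (cases p; auto simp: conjugate_exponent_def one_ereal_def divide_simps)+

text \<open>
  For \<^term>\<open>p = 1\<close> the coefficient space is that of null sequences, by the convention
  in \<^const>\<open>lp_seqs\<close>.
\<close>

definition coeff_ball :: "ereal \<Rightarrow> (nat \<Rightarrow> complex) set"
  where "coeff_ball p =
    {\<alpha> \<in> lp_seqs (conjugate_exponent p). lp_norm (conjugate_exponent p) \<alpha> \<le> 1}"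

definition synthesis :: "(nat \<Rightarrow> 'v :: complex_normed_vector) \<Rightarrow> (nat \<Rightarrow> complex) \<Rightarrow> 'v"
  where "synthesis v \<alpha> = (\<Sum>n. \<alpha> n *\<^sub>C v n)"

definition p_compact_witnesses ::
    "ereal \<Rightarrow> ('u :: complex_banach \<Rightarrow>\<^sub>B 'v :: complex_banach) \<Rightarrow> (nat \<Rightarrow> 'v) set"
  where "p_compact_witnesses p S =
    {v \<in> lp_seqs p. cblinfun_apply S ` cball 0 1 \<subseteq> synthesis v ` coeff_ball p}"

definition p_compact :: "ereal \<Rightarrow> ('u :: complex_banach \<Rightarrow>\<^sub>B 'v :: complex_banach) set"
  where "p_compact p = {S. p_compact_witnesses p S \<noteq> {}}"

definition p_compact_norm ::
    "ereal \<Rightarrow> ('u :: complex_banach \<Rightarrow>\<^sub>B 'v :: complex_banach) \<Rightarrow> real"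
  where "p_compact_norm p S = (INF v \<in> p_compact_witnesses p S. lp_norm p v)"

definition dual_p_compact :: "ereal \<Rightarrow> ('u :: complex_banach \<Rightarrow>\<^sub>B 'v :: complex_banach) set"
  where "dual_p_compact p = {S. adjoint S \<in> p_compact p}"

definition dual_p_compact_norm ::
    "ereal \<Rightarrow> ('u :: complex_banach \<Rightarrow>\<^sub>B 'v :: complex_banach) \<Rightarrow> real"
  where "dual_p_compact_norm p S = p_compact_norm p (adjoint S)"

end

theory Submission
  imports Defs
begin

text \<open>
  Represent \<open>T\<^sup>*\<close> on the dual ball of \<open>Y\<close> by a strongly \<open>p\<close>-summable sequence \<open>v\<close> of functionals on
  \<open>X\<close> of almost optimal norm and coefficients \<open>\<alpha> \<phi>\<close> in the unit ball of \<open>\<ell>\<^sub>q\<close>.  Extend each \<open>v n\<close>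
  by Hahn--Banach to \<open>f n\<close> on \<open>Z\<close> and put \<open>T' = (\<Sum>n. f n \<otimes> a n)\<close>, where \<open>a n\<close> is the bounded
  function \<open>\<phi> \<mapsto> \<alpha> \<phi> n\<close>; by Hoelder's inequality the series converges in operator norm.  Then
  \<open>T'\<^sup>* \<mu> = (\<Sum>n. \<mu> (a n) f n)\<close>, and \<open>\<ell>\<^sub>p\<close>-duality puts \<open>(\<mu> (a n))\<^sub>n\<close> in the unit ball of \<open>\<ell>\<^sub>q\<close>.  For
  \<open>p = 1\<close> this gives only a bounded sequence instead of a null sequence; there the \<open>f n\<close> are
  multiplied by weights tending to infinity slowly enough to increase the norm of \<open>f\<close> by at
  most \<open>\<epsilon>/2\<close>.
\<close>

section \<open>The Hahn--Banach theorem\<close>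

definition sublinear :: "('a :: real_vector \<Rightarrow> real) \<Rightarrow> bool"
  where "sublinear q \<longleftrightarrow> (\<forall>x y. q (x + y) \<le> q x + q y) \<and> (\<forall>r x. 0 < r \<longrightarrow> q (r *\<^sub>R x) = r * q x)"

lemma sublinear_add: "sublinear q \<Longrightarrow> q (x + y) \<le> q x + q y"
  and sublinear_scaleR_pos: "sublinear q \<Longrightarrow> 0 < r \<Longrightarrow> q (r *\<^sub>R x) = r * q x"
  by (auto simp: sublinear_def)

lemma sublinear_0:
  assumes "sublinear q"
  shows "q 0 = 0"
  using sublinear_scaleR_pos[OF assms, of 2 0] by simp

lemma sublinear_scaleR: "sublinear q \<Longrightarrow> 0 \<le> r \<Longrightarrow> q (r *\<^sub>R x) = r * q x"
  by (cases "r = 0") (auto simp: sublinear_0 sublinear_scaleR_pos)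

lemma sublinear_minus_le:
  assumes "sublinear q"
  shows "- q (- x) \<le> q x"
  using sublinear_add[OF assms, of x "- x"] sublinear_0[OF assms] by simp

lemma sublinear_norm: "0 \<le> c \<Longrightarrow> sublinear (\<lambda>x. c * norm x)"
  using mult_left_mono[OF norm_triangle_ineq, of c]
  by (auto simp: sublinear_def distrib_left[symmetric])

text \<open>The infimum inherits subadditivity and homogeneity as soon as every combination of
  members is dominated by some further member. This covers chains as well as the two parametrised
  infima used later.\<close>

lemma sublinear_INF:
  fixes f :: "'i \<Rightarrow> 'a :: real_vector \<Rightarrow> real"
  assumes "I \<noteq> {}" and bdd: "\<And>x. bdd_below ((\<lambda>i. f i x) ` I)"
    and add: "\<And>i j x y. i \<in> I \<Longrightarrow> j \<in> I \<Longrightarrow> \<exists>k\<in>I. f k (x + y) \<le> f i x + f j y"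
    and scale: "\<And>i r x. i \<in> I \<Longrightarrow> 0 < r \<Longrightarrow> \<exists>k\<in>I. f k (r *\<^sub>R x) \<le> r * f i x"
  shows "sublinear (\<lambda>x. INF i\<in>I. f i x)"
  unfolding sublinear_def
proof (intro conjI allI impI)
  let ?g = "\<lambda>x. INF i\<in>I. f i x"
  have lower: "?g x \<le> f i x" if "i \<in> I" for i x
    by (rule cINF_lower[OF bdd that])
  show "?g (x + y) \<le> ?g x + ?g y" for x y
  proof -
    have "?g (x + y) - f i x \<le> f j y" if "i \<in> I" "j \<in> I" for i j
    proof -
      from add[OF that, of x y] obtain k where "k \<in> I" "f k (x + y) \<le> f i x + f j y" by blast
      with lower[of k "x + y"] show ?thesis by simp
    qed
    then have "?g (x + y) - f i x \<le> ?g y" if "i \<in> I" for i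
      using \<open>I \<noteq> {}\<close> that by (intro cINF_greatest) auto
    then have "?g (x + y) - ?g y \<le> f i x" if "i \<in> I" for i
      using that by (simp add: algebra_simps)
    then have "?g (x + y) - ?g y \<le> ?g x"
      using \<open>I \<noteq> {}\<close> by (intro cINF_greatest) auto
    then show ?thesis by simp
  qed
  have le: "?g (r *\<^sub>R x) \<le> r * ?g x" if "0 < r" for r x
  proof -
    have "?g (r *\<^sub>R x) / r \<le> f i x" if "i \<in> I" for i
    proof -
      from scale[OF that \<open>0 < r\<close>] obtain k where "k \<in> I" "f k (r *\<^sub>R x) \<le> r * f i x" by blast
      with lower[of k "r *\<^sub>R x"] have "?g (r *\<^sub>R x) \<le> r * f i x" by simp
      then show ?thesis using \<open>0 < r\<close> by (simp add: field_simps)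
    qed
    then have "?g (r *\<^sub>R x) / r \<le> ?g x"
      using \<open>I \<noteq> {}\<close> by (intro cINF_greatest) auto
    then show ?thesis using \<open>0 < r\<close> by (simp add: field_simps)
  qed
  \<comment> \<open>The reverse inequality is \<open>le\<close> for the factor
    \<open>inverse r\<close> at the point \<open>r *\<^sub>R x\<close>.\<close>
  show "?g (r *\<^sub>R x) = r * ?g x" if "0 < r" for r x
    using le[OF that, of x] le[of "inverse r" "r *\<^sub>R x"] that
    by (simp add: field_simps)
qed

text \<open>Zorn's lemma for the reversed pointwise order. The infimum of a nonempty chain is
  finite, since every sublinear \<open>f\<close> below \<open>q\<close> has
  \<open>f x >= - f (- x) >= - q (- x)\<close>; it is sublinear because the smaller of two chain
  members serves for both.\<close>

lemma minimal_sublinear_below: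
  fixes q :: "'a :: real_vector \<Rightarrow> real"
  assumes q: "sublinear q"
  obtains p where "sublinear p" "p \<le> q" "\<And>r. sublinear r \<Longrightarrow> r \<le> p \<Longrightarrow> r = p"
proof -
  let ?A = "{p. sublinear p \<and> p \<le> q}"
  have "\<exists>p\<in>?A. \<forall>r\<in>?A. r \<le> p \<longrightarrow> r = p"
  proof (rule predicate_Zorn)
    show "partial_order_on ?A (relation_of (\<ge>) ?A)"
      by (rule partial_order_on_relation_ofI) auto
    fix C assume C: "C \<in> Chains (relation_of (\<ge>) ?A)"
    have CA: "C \<subseteq> ?A"
    proof
      fix f assume "f \<in> C"
      then have "(f, f) \<in> relation_of (\<ge>) ?A"
        using C unfolding Chains_def by blast
      then show "f \<in> ?A" by (simp add: relation_of_def)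
    qed
    have tot: "f \<le> g \<or> g \<le> f" if "f \<in> C" "g \<in> C" for f g
      using C that by (auto simp: Chains_def relation_of_def)
    show "\<exists>u\<in>?A. \<forall>a\<in>C. u \<le> a"
    proof (cases "C = {}")
      case True
      then show ?thesis using q by auto
    next
      case False
      have bdd: "bdd_below ((\<lambda>f. f x) ` C)" for x
      proof (rule bdd_belowI2[where m = "- q (- x)"])
        fix f assume "f \<in> C"
        then have "sublinear f" "f (- x) \<le> q (- x)"
          using CA by (auto simp: le_fun_def)
        then show "- q (- x) \<le> f x"
          using sublinear_minus_le[of f x] by linarith
      qed
      let ?u = "\<lambda>x. INF f\<in>C. f x"
      have "sublinear ?u"
      proof (rule sublinear_INF[OF False bdd])
        fix f g x y assume fg: "f \<in> C" "g \<in> C"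
        then have *: "sublinear f" "sublinear g" using CA by auto
        from tot[OF fg] show "\<exists>k\<in>C. k (x + y) \<le> f x + g y"
        proof
          assume "f \<le> g"
          then show ?thesis
            using fg sublinear_add[OF *(1), of x y] le_funD[of f g y]
            by (intro bexI[of _ f]) auto
        next
          assume "g \<le> f"
          then show ?thesis
            using fg sublinear_add[OF *(2), of x y] le_funD[of g f x]
            by (intro bexI[of _ g]) auto
        qed
      next
        fix f x and r :: real assume "f \<in> C" "0 < r"
        then show "\<exists>k\<in>C. k (r *\<^sub>R x) \<le> r * f x"
          using CA sublinear_scaleR_pos[of f r x] by (intro bexI[of _ f]) auto
      qed
      moreover have below: "?u \<le> f" if "f \<in> C" for f
        using cINF_lower[OF bdd that] by (simp add: le_fun_def)
      moreover have "?u \<le> q"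
        using False CA below order_trans by blast
      ultimately show ?thesis by auto
    qed
  qed
  then obtain p where p: "sublinear p" "p \<le> q" "\<And>r. sublinear r \<Longrightarrow> r \<le> q \<Longrightarrow> r \<le> p \<Longrightarrow> r = p"
    by blast
  show thesis
    using p(1,2) by (rule that) (use p order_trans in blast)
qed

text \<open>
  For fixed \<open>y\<close>, the infimum over \<open>t \<ge> 0\<close> of \<open>p (x + t y) - t p y\<close> is again a sublinear function
  of \<open>x\<close> below \<open>p\<close>, and its value at \<open>- y\<close> is at most \<open>- p y\<close>.
\<close>

lemma minimal_sublinear_linear:
  fixes p :: "'a :: real_vector \<Rightarrow> real"
  assumes p: "sublinear p" and min: "\<And>r. sublinear r \<Longrightarrow> r \<le> p \<Longrightarrow> r = p"
  shows "linear p"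
proof -
  have minus: "p (- y) = - p y" for y
  proof -
    let ?f = "\<lambda>t x. p (x + t *\<^sub>R y) - t * p y"
    let ?r = "\<lambda>x. INF t\<in>{0 :: real..}. ?f t x"
    have bdd: "bdd_below ((\<lambda>t. ?f t x) ` {0..})" for x
    proof (rule bdd_belowI2[where m = "- p (- x)"])
      fix t :: real assume "t \<in> {0..}"
      then show "- p (- x) \<le> ?f t x"
        using sublinear_add[OF p, of "x + t *\<^sub>R y" "- x"] sublinear_scaleR[OF p, of t y] by simp
    qed
    have lower: "?r x \<le> ?f t x" if "0 \<le> t" for t x
      using that by (intro cINF_lower[OF bdd]) simp
    have "sublinear ?r"
    proof (rule sublinear_INF[OF _ bdd])
      fix s t :: real and x z :: 'a assume "s \<in> {0..}" "t \<in> {0..}"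
      then show "\<exists>k\<in>{0..}. ?f k (x + z) \<le> ?f s x + ?f t z"
        using sublinear_add[OF p, of "x + s *\<^sub>R y" "z + t *\<^sub>R y"]
        by (intro bexI[of _ "s + t"]) (auto simp: algebra_simps)
    next
      fix t r :: real and x :: 'a assume "t \<in> {0..}" "0 < r"
      then show "\<exists>k\<in>{0..}. ?f k (r *\<^sub>R x) \<le> r * ?f t x"
        using sublinear_scaleR_pos[OF p \<open>0 < r\<close>, of "x + t *\<^sub>R y"]
        by (intro bexI[of _ "r * t"]) (auto simp: algebra_simps)
    qed simp
    moreover have "?r \<le> p"
      using lower[of 0] by (simp add: le_fun_def)
    ultimately have "?r = p" by (rule min)
    then have "p (- y) = ?r (- y)" by (rule fun_cong[OF sym])
    also have "\<dots> \<le> ?f 1 (- y)" by (rule lower) simp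
    finally have "p (- y) \<le> - p y"
      using sublinear_0[OF p] by simp
    then show ?thesis
      using sublinear_minus_le[OF p, of y] by simp
  qed
  show ?thesis
  proof (rule linearI)
    \<comment> \<open>As \<open>p\<close> is odd, subadditivity at \<open>- x\<close> and
      \<open>- y\<close> is the reverse inequality.\<close>
    show "p (x + y) = p x + p y" for x y
      using sublinear_add[OF p, of x y] sublinear_add[OF p, of "- x" "- y"] minus[of "x + y"]
      by (simp add: minus)
    show "p (r *\<^sub>R x) = r *\<^sub>R p x" for r x
      using sublinear_scaleR[OF p, of r x] sublinear_scaleR[OF p, of "- r" x] minus[of "r *\<^sub>R x"]
      by (cases "0 \<le> r") auto
  qed
qed

text \<open>The infimum \<open>?r\<close> lies below \<open>q\<close> (take \<open>x = 0\<close>)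
  and, at \<open>j x\<close>, below \<open>f x\<close>. A minimal sublinear function under it is
  linear, and a linear function dominated by \<open>f\<close> along \<open>j\<close> equals
  \<open>f\<close> there, as \<open>- x\<close> gives the reverse inequality.\<close>

theorem hahn_banach_sublinear:
  fixes q :: "'b :: real_vector \<Rightarrow> real" and j :: "'a :: real_vector \<Rightarrow> 'b"
  assumes q: "sublinear q" and "linear j" "linear f" and le: "\<And>x. f x \<le> q (j x)"
  obtains g where "linear g" "\<And>x. g (j x) = f x" "\<And>z. g z \<le> q z"
proof -
  interpret j: linear j by fact
  interpret f: linear f by fact
  let ?r = "\<lambda>z. INF x. f x + q (z - j x)"
  have bdd: "bdd_below (range (\<lambda>x. f x + q (z - j x)))" for z
  proof (rule bdd_belowI2[where m = "- q (- z)"])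
    fix x
    \<comment> \<open>By subadditivity \<open>q (- z) + q (z - j x)\<close> is at least
      \<open>q (j (- x))\<close>, which dominates \<open>f (- x) = - f x\<close>.\<close>
    show "- q (- z) \<le> f x + q (z - j x)"
      using le[of "- x"] sublinear_add[OF q, of "- z" "z - j x"] by (simp add: j.neg f.neg)
  qed
  have lower: "?r z \<le> f x + q (z - j x)" for x z
    by (rule cINF_lower[OF bdd]) simp
  have "sublinear ?r"
  proof (rule sublinear_INF[OF _ bdd])
    fix x x' z z'
    show "\<exists>k\<in>UNIV. f k + q (z + z' - j k) \<le> f x + q (z - j x) + (f x' + q (z' - j x'))"
      using sublinear_add[OF q, of "z - j x" "z' - j x'"]
      by (intro bexI[of _ "x + x'"]) (auto simp: j.add f.add algebra_simps)
  next
    fix x z and r :: real assume "0 < r"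
    then show "\<exists>k\<in>UNIV. f k + q (r *\<^sub>R z - j k) \<le> r * (f x + q (z - j x))"
      using sublinear_scaleR_pos[OF q, of r "z - j x"]
      by (intro bexI[of _ "r *\<^sub>R x"]) (auto simp: j.scaleR f.scaleR algebra_simps)
  qed simp
  then obtain p where p: "sublinear p" "p \<le> ?r" "\<And>r. sublinear r \<Longrightarrow> r \<le> p \<Longrightarrow> r = p"
    by (rule minimal_sublinear_below) blast
  from p(1,3) have "linear p" by (rule minimal_sublinear_linear)
  interpret p: linear p by fact
  have le_f: "p (j x) \<le> f x" for x
    using le_funD[OF p(2), of "j x"] lower[of "j x" x] sublinear_0[OF q] by simp
  show thesis
  proof (rule that[OF \<open>linear p\<close>])
    show "p (j x) = f x" for x
      using le_f[of x] le_f[of "- x"] by (simp add: j.neg f.neg p.neg)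
    show "p z \<le> q z" for z
      using le_funD[OF p(2), of z] lower[of z 0] by (simp add: j.zero f.zero)
  qed
qed

section \<open>Norm-preserving extension of complex functionals\<close>

lemma cblinfun_linear: "linear (cblinfun_apply f)"
  by (rule bounded_linear.linear[OF bounded_linear_apply])

lemma cblinfun_scaleC: "cblinfun_apply f (c *\<^sub>C x) = c *\<^sub>C cblinfun_apply f x"
  using bounded_clinear_apply by (auto simp: bounded_clinear_def)

theorem hahn_banach_complex:
  fixes J :: "'x :: complex_normed_vector \<Rightarrow>\<^sub>B 'z :: complex_normed_vector" and f :: "'x cdual"
  assumes iso: "\<And>x. norm (J x) = norm x"
  obtains g :: "'z cdual" where "\<And>x. g (J x) = f x" "norm g = norm f"
proof -
  have "linear (\<lambda>x. Re (f x))"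
    using linear_compose[OF cblinfun_linear[of f] bounded_linear.linear[OF bounded_linear_Re]]
    by (simp add: o_def)
  moreover have "Re (f x) \<le> norm f * norm (J x)" for x
    using complex_Re_le_cmod[of "f x"] norm_cblinfun[of f x] by (simp add: iso)
  ultimately obtain G where G: "linear G" "\<And>x. G (J x) = Re (f x)" "\<And>z. G z \<le> norm f * norm z"
    using hahn_banach_sublinear[OF sublinear_norm[OF norm_ge_zero[of f]] cblinfun_linear[of J]] by metis
  interpret G: linear G by (rule G(1))
  have i: "a *\<^sub>C z = Re a *\<^sub>R z + Im a *\<^sub>R (\<i> *\<^sub>C z)" for a and z :: 'z
    by (metis complex_eq mult.commute scaleC_add_left scaleC_of_real scaleC_scaleC)
  have ii: "\<i> *\<^sub>C \<i> *\<^sub>C z = - z" for z :: 'z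
    using scaleC_of_real[of "- 1" z] by (simp add: scaleC_scaleC)
  \<comment> \<open>A complex-linear functional is determined by its real part \<open>G\<close>
    through \<open>F z = G z - \<i> * G (\<i> *\<^sub>C z)\<close>.\<close>
  define F where "F z = Complex (G z) (- G (\<i> *\<^sub>C z))" for z
  have F_scaleC: "F (a *\<^sub>C z) = a *\<^sub>C F z" for a z
  proof -
    have "\<i> *\<^sub>C a *\<^sub>C z = Re a *\<^sub>R (\<i> *\<^sub>C z) - Im a *\<^sub>R z"
      by (subst i[of a]) (simp add: scaleC_add_right scaleC_scaleR ii)
    then show ?thesis
      using i[of a z]
      by (simp add: F_def scaleC_complex_def complex_eq_iff G.add G.diff G.scaleR)
  qed
  have F_norm: "norm (F z) \<le> norm f * norm z" for z
  proof (cases "F z = 0")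
    case False
    \<comment> \<open>The unimodular factor \<open>u\<close> rotates \<open>F z\<close> to the
      positive real number \<open>cmod (F z)\<close>, which is then a value of \<open>G\<close> and
      obeys its bound.\<close>
    define u where "u = cnj (F z) / cmod (F z)"
    have u: "cmod u = 1" using False by (simp add: u_def norm_divide)
    have "F (u *\<^sub>C z) = cmod (F z)"
      using False
      by (simp add: F_scaleC scaleC_complex_def u_def field_simps
          complex_norm_square[symmetric] power2_eq_square)
    then have "cmod (F z) = G (u *\<^sub>C z)"
      by (simp add: F_def complex_eq_iff)
    also have "\<dots> \<le> norm f * norm z"
      using G(3)[of "u *\<^sub>C z"] by (simp add: norm_scaleC u)
    finally show ?thesis .
  qed simp
  have "bounded_linear F"
    by (rule bounded_linear_intro[where K = "norm f"])
      (use F_norm in \<open>auto simp: F_def complex_eq_iff G.add G.scaleR scaleC_add_right scaleC_scaleR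
          mult.commute\<close>)
  then have "bounded_clinear F"
    by (simp add: bounded_clinear_def F_scaleC)
  then obtain g :: "'z cdual" where g: "cblinfun_apply g = F"
    using CBlinfun_inverse by blast
  have gJ: "g (J x) = f x" for x
    by (simp add: g F_def complex_eq_iff G(2) cblinfun_scaleC[symmetric])
      (simp add: cblinfun_scaleC scaleC_complex_def)
  have "norm g \<le> norm f"
    by (rule norm_cblinfun_bound) (use F_norm g in auto)
  moreover have "norm f \<le> norm g"
  proof (rule norm_cblinfun_bound)
    show "norm (f x) \<le> norm g * norm x" for x
      using norm_cblinfun[of g "J x"] by (simp add: gJ iso)
  qed simp
  ultimately show thesis
    using that gJ by force
qed

section \<open>Spaces of p-summable sequences\<close>

text \<open>At both end points one side of the duality consists of null sequences with the supremum
  norm and the other of absolutely summable ones. Strictly between, both exponents are real and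
  greater than 1, as Young's inequality requires.\<close>

lemma exponent_cases [consumes 1, case_names one infinity real]:
  assumes "1 \<le> p"
  obtains "p = 1" "conjugate_exponent p = \<infinity>"
  | "p = \<infinity>" "conjugate_exponent p = 1"
  | r s where "p = ereal r" "conjugate_exponent p = ereal s" "1 < r" "1 < s" "1 / r + 1 / s = 1"
proof (cases p)
  case (real r)
  show thesis
  proof (cases "r = 1")
    case True
    then show thesis using that(1) real by (simp add: conjugate_exponent_def one_ereal_def)
  next
    case False
    with assms real have "1 < r" by simp
    then show thesis
      using that(3)[of r "r / (r - 1)"] real
      by (simp add: conjugate_exponent_def one_ereal_def divide_simps)
  qed
qed (use assms that(2) in \<open>auto simp: conjugate_exponent_def one_ereal_def\<close>)

lemma lp_seqs_ereal: "v \<in> lp_seqs (ereal r) \<longleftrightarrow> summable (\<lambda>n. norm (v n) powr r)"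
  and lp_norm_ereal: "lp_norm (ereal r) v = (\<Sum>n. norm (v n) powr r) powr (1 / r)"
  and lp_seqs_infinity: "v \<in> lp_seqs \<infinity> \<longleftrightarrow> v \<longlonglongrightarrow> 0"
  and lp_norm_infinity: "lp_norm \<infinity> v = (SUP n. norm (v n))"
  by (auto simp: lp_seqs_def lp_norm_def)

lemma lp_seqs_1: "v \<in> lp_seqs 1 \<longleftrightarrow> summable (\<lambda>n. norm (v n))"
  by (simp add: one_ereal_def lp_seqs_ereal)

lemma lp_norm_1: "v \<in> lp_seqs 1 \<Longrightarrow> lp_norm 1 v = (\<Sum>n. norm (v n))"
  using suminf_nonneg[of "\<lambda>n. norm (v n)"]
  by (simp add: one_ereal_def lp_seqs_ereal lp_norm_ereal)

text \<open>Only the norms of the terms matter, and the two sequences may live in different spaces.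
  This carries summability and norm from functionals on \<open>X\<close> over to their extensions to
  \<open>Z\<close>.\<close>

lemma lp_cong:
  assumes "\<And>n. norm (v n) = norm (w n)"
  shows "v \<in> lp_seqs p \<longleftrightarrow> w \<in> lp_seqs p" "lp_norm p v = lp_norm p w"
  using assms by (auto simp: lp_seqs_def lp_norm_def tendsto_norm_zero_iff[symmetric, of v]
      tendsto_norm_zero_iff[symmetric, of w])

lemma norm_le_lp_norm_infinity:
  assumes "v \<in> lp_seqs \<infinity>"
  shows "norm (v n) \<le> lp_norm \<infinity> v"
proof -
  have "Bseq v"
    using assms by (auto simp: lp_seqs_infinity intro: convergent_imp_Bseq convergentI)
  then have "bdd_above (range (\<lambda>n. norm (v n)))"
    by (auto simp: Bseq_def bdd_above_def)
  then show ?thesis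
    unfolding lp_norm_infinity by (intro cSUP_upper) auto
qed

lemma lp_norm_nonneg: "v \<in> lp_seqs p \<Longrightarrow> 0 \<le> lp_norm p v"
proof (cases "p = \<infinity>")
  case True
  then show "v \<in> lp_seqs p \<Longrightarrow> ?thesis"
    using norm_le_lp_norm_infinity[of v 0] norm_ge_zero[of "v 0"] by (metis order_trans)
qed (simp add: lp_norm_def)

lemma suminf_eq_lp_norm_powr:
  assumes "v \<in> lp_seqs (ereal r)" "0 < r"
  shows "(\<Sum>n. norm (v n) powr r) = lp_norm (ereal r) v powr r"
  using assms by (simp add: lp_norm_ereal lp_seqs_ereal powr_powr suminf_nonneg)

text \<open>At the end points one factor is bounded by its supremum; otherwise Young's inequality is
  summed after division by the norm of \<open>v\<close>. Finite index sets make the bound usable for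
  partial sums and truncations alike.\<close>

lemma lp_holder:
  assumes "1 \<le> p" and \<alpha>: "\<alpha> \<in> coeff_ball p" and v: "v \<in> lp_seqs p" and "finite F"
  shows "(\<Sum>n\<in>F. cmod (\<alpha> n) * norm (v n)) \<le> lp_norm p v"
  using \<open>1 \<le> p\<close>
proof (cases p rule: exponent_cases)
  case one
  then have \<alpha>1: "cmod (\<alpha> n) \<le> 1" for n
    using \<alpha> norm_le_lp_norm_infinity[of \<alpha> n] by (simp add: coeff_ball_def)
  have "(\<Sum>n\<in>F. cmod (\<alpha> n) * norm (v n)) \<le> (\<Sum>n\<in>F. norm (v n))"
    by (intro sum_mono mult_left_le_one_le) (auto simp: \<alpha>1)
  also have "\<dots> \<le> (\<Sum>n. norm (v n))"
    using v one \<open>finite F\<close> by (intro sum_le_suminf) (auto simp: lp_seqs_1)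
  also have "\<dots> = lp_norm p v"
    using v one by (simp add: lp_norm_1)
  finally show ?thesis .
next
  case infinity
  then have \<alpha>1: "\<alpha> \<in> lp_seqs 1" "lp_norm 1 \<alpha> \<le> 1"
    using \<alpha> by (auto simp: coeff_ball_def)
  have "(\<Sum>n\<in>F. cmod (\<alpha> n) * norm (v n)) \<le> (\<Sum>n\<in>F. cmod (\<alpha> n)) * lp_norm p v"
    unfolding sum_distrib_right
    using v infinity norm_le_lp_norm_infinity by (intro sum_mono mult_left_mono) auto
  also have "\<dots> \<le> 1 * lp_norm p v"
  proof (intro mult_right_mono lp_norm_nonneg v)
    have "(\<Sum>n\<in>F. cmod (\<alpha> n)) \<le> (\<Sum>n. cmod (\<alpha> n))"
      using \<alpha>1 \<open>finite F\<close> by (intro sum_le_suminf) (auto simp: lp_seqs_1)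
    then show "(\<Sum>n\<in>F. cmod (\<alpha> n)) \<le> 1"
      using \<alpha>1 by (simp add: lp_norm_1)
  qed
  finally show ?thesis by simp
next
  case (real r s)
  then have \<alpha>s: "\<alpha> \<in> lp_seqs (ereal s)" "lp_norm (ereal s) \<alpha> \<le> 1" and vr: "v \<in> lp_seqs (ereal r)"
    using \<alpha> v by (auto simp: coeff_ball_def)
  define V where "V = lp_norm p v"
  have sum_v: "(\<Sum>n\<in>F. norm (v n) powr r) \<le> V powr r"
    using vr real \<open>finite F\<close> sum_le_suminf[of "\<lambda>n. norm (v n) powr r" F]
    by (simp add: suminf_eq_lp_norm_powr lp_seqs_ereal V_def)
  have "(\<Sum>n\<in>F. cmod (\<alpha> n) powr s) \<le> lp_norm (ereal s) \<alpha> powr s"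
    using \<alpha>s real \<open>finite F\<close> sum_le_suminf[of "\<lambda>n. cmod (\<alpha> n) powr s" F]
    by (simp add: suminf_eq_lp_norm_powr lp_seqs_ereal)
  also have "\<dots> \<le> 1"
    using \<alpha>s real lp_norm_nonneg[OF \<alpha>s(1)] powr_mono2[of s "lp_norm (ereal s) \<alpha>" 1] by simp
  finally have sum_\<alpha>: "(\<Sum>n\<in>F. cmod (\<alpha> n) powr s) \<le> 1" .
  show ?thesis
  \<comment> \<open>For \<open>V = 0\<close> normalising is impossible, but then all
    \<open>v n\<close> with \<open>n\<close> in \<open>F\<close> vanish.\<close>
  proof (cases "V = 0")
    case True
    then have "(\<Sum>n\<in>F. norm (v n) powr r) = 0"
      using sum_v by (intro antisym sum_nonneg) auto
    then have "\<forall>n\<in>F. v n = 0"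
      using \<open>finite F\<close> by (simp add: sum_nonneg_eq_0_iff)
    then show ?thesis using lp_norm_nonneg[OF v] by simp
  next
    case False
    then have V: "0 < V" using lp_norm_nonneg[OF v] by (simp add: V_def)
    have "(\<Sum>n\<in>F. cmod (\<alpha> n) * (norm (v n) / V))
        \<le> (\<Sum>n\<in>F. cmod (\<alpha> n) powr s / s + (norm (v n) / V) powr r / r)"
      using real V by (intro sum_mono Youngs_inequality) (auto simp: add.commute)
    also have "\<dots> = (\<Sum>n\<in>F. cmod (\<alpha> n) powr s) / s + (\<Sum>n\<in>F. norm (v n) powr r) / V powr r / r"
      using V by (simp add: sum.distrib sum_divide_distrib powr_divide)
    also have "\<dots> \<le> 1 / s + 1 / r"
      using sum_\<alpha> sum_v V real by (intro add_mono divide_right_mono) (auto simp: field_simps)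
    finally have "(\<Sum>n\<in>F. cmod (\<alpha> n) * norm (v n)) / V \<le> 1"
      using real by (simp add: sum_divide_distrib)
    then show ?thesis using V by (simp add: V_def field_simps)
  qed
qed

lemma summable_synthesis:
  fixes v :: "nat \<Rightarrow> 'v :: complex_banach"
  assumes "1 \<le> p" "\<alpha> \<in> coeff_ball p" "v \<in> lp_seqs p"
  shows "summable (\<lambda>n. \<alpha> n *\<^sub>C v n)"
proof (rule summable_norm_cancel, rule summableI_nonneg_bounded)
  show "(\<Sum>n<N. norm (\<alpha> n *\<^sub>C v n)) \<le> lp_norm p v" for N
    using lp_holder[OF assms, of "{..<N}"] by (simp add: norm_scaleC)
qed simp

section \<open>Truncated sequences and tails\<close>

definition restrict_seq :: "nat set \<Rightarrow> (nat \<Rightarrow> 'v :: complex_normed_vector) \<Rightarrow> nat \<Rightarrow> 'v"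
  where "restrict_seq F v n = (if n \<in> F then v n else 0)"

lemma restrict_seq_lp_seqs:
  assumes "finite F"
  shows "restrict_seq F v \<in> lp_seqs p"
proof (cases "p = \<infinity>")
  case True
  obtain N where N: "\<forall>n\<in>F. n < N"
    using assms finite_nat_set_iff_bounded by blast
  have "restrict_seq F v n = 0" if "N \<le> n" for n
    using N that leD unfolding restrict_seq_def by auto
  then have "\<forall>\<^sub>F n in sequentially. restrict_seq F v n = 0"
    by (rule eventually_sequentiallyI)
  then show ?thesis using True by (simp add: lp_seqs_infinity tendsto_eventually)
next
  case False
  then show ?thesis
    unfolding lp_seqs_def using assms
    by (auto simp: restrict_seq_def intro!: summable_finite[of F])
qed

lemma lp_norm_restrict_seq_ereal:
  assumes "finite F"
  shows "lp_norm (ereal r) (restrict_seq F v) = (\<Sum>n\<in>F. norm (v n) powr r) powr (1 / r)"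
proof -
  have "(\<Sum>n. norm (restrict_seq F v n) powr r) = (\<Sum>n\<in>F. norm (restrict_seq F v n) powr r)"
    using assms by (intro suminf_finite) (auto simp: restrict_seq_def)
  then show ?thesis by (simp add: lp_norm_ereal restrict_seq_def)
qed

lemma lp_norm_restrict_seq_infinity_le:
  assumes "0 \<le> b" "\<And>n. n \<in> F \<Longrightarrow> norm (v n) \<le> b"
  shows "lp_norm \<infinity> (restrict_seq F v) \<le> b"
  unfolding lp_norm_infinity using assms by (intro cSUP_least) (auto simp: restrict_seq_def)

lemma lp_norm_restrict_seq_singleton_le:
  assumes "1 \<le> p"
  shows "lp_norm p (restrict_seq {k} (\<lambda>_. 1 :: complex)) \<le> 1"
  using assms
  by (cases p) (auto simp: lp_norm_restrict_seq_ereal intro: lp_norm_restrict_seq_infinity_le)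

text \<open>Hoelder's inequality is tested on the unit vector at \<open>k\<close>.\<close>

lemma coeff_ball_le_1:
  assumes "1 \<le> p" "\<alpha> \<in> coeff_ball p"
  shows "cmod (\<alpha> k) \<le> 1"
  using lp_holder[OF assms restrict_seq_lp_seqs, of "{k}" "{k}" "\<lambda>_. 1 :: complex"]
    lp_norm_restrict_seq_singleton_le[OF assms(1), of k]
  by (simp add: restrict_seq_def[of _ _ k])

text \<open>For finite \<open>p\<close> this is Cauchy's criterion for the series of powers; for
  infinite \<open>p\<close> it rests on the sequences being null and not merely bounded.\<close>

lemma lp_norm_tail:
  assumes "1 \<le> p" and v: "v \<in> lp_seqs p" and "0 < e"
  shows "\<exists>N. \<forall>m\<ge>N. \<forall>n. lp_norm p (restrict_seq {m..<n} v) \<le> e"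
proof (cases p)
  case (real r)
  then have r: "1 \<le> r" using assms by simp
  have "0 < e powr r" using assms by simp
  then obtain N where N: "\<And>m n. N \<le> m \<Longrightarrow> norm (\<Sum>k=m..<n. norm (v k) powr r) < e powr r"
    using v unfolding real lp_seqs_ereal summable_Cauchy by blast
  have "lp_norm p (restrict_seq {m..<n} v) \<le> e" if "N \<le> m" for m n
  proof -
    have "(\<Sum>k=m..<n. norm (v k) powr r) powr (1 / r) \<le> (e powr r) powr (1 / r)"
      using N[OF that, of n] r by (intro powr_mono2) (auto intro: sum_nonneg)
    then show ?thesis
      using r \<open>0 < e\<close> by (simp add: real lp_norm_restrict_seq_ereal powr_powr)
  qed
  then show ?thesis by blast
next
  case PInf
  then obtain N where "\<And>n. N \<le> n \<Longrightarrow> norm (v n) < e"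
    using LIMSEQ_D[of v 0 e] v \<open>0 < e\<close> by (auto simp: lp_seqs_infinity)
  then have "lp_norm p (restrict_seq {m..<n} v) \<le> e" if "N \<le> m" for m n
    unfolding PInf using that \<open>0 < e\<close>
    by (intro lp_norm_restrict_seq_infinity_le) (auto intro: less_imp_le)
  then show ?thesis by blast
qed (use assms in auto)

lemma cnj_sgn_mult: "cnj (sgn z) * z = complex_of_real (cmod z)"
  by (cases "z = 0") (simp_all add: sgn_eq field_simps complex_norm_square[symmetric] power2_eq_square)

text \<open>Testing \<open>bound\<close> on the extremal sequences of Hoelder's inequality recovers
  the norm of \<open>\<gamma>\<close>. For \<open>p = 1\<close> this would only give
  \<open>cmod (\<gamma> n) \<le> 1\<close>, whereas the coefficient ball then consists of null
  sequences.\<close>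

lemma coeff_ballI_dual:
  assumes "1 \<le> p" "p \<noteq> 1"
    and bound: "\<And>c N. cmod (\<Sum>n<N. c n * \<gamma> n) \<le> lp_norm p (restrict_seq {..<N} c)"
  shows "\<gamma> \<in> coeff_ball p"
  using \<open>1 \<le> p\<close>
proof (cases p rule: exponent_cases)
  case infinity
  have le: "(\<Sum>n<N. cmod (\<gamma> n)) \<le> 1" for N
  proof -
    \<comment> \<open>The conjugate phases have supremum norm at most 1 and turn the sum into the
      sum of moduli.\<close>
    have "(\<Sum>n<N. cmod (\<gamma> n)) = cmod (\<Sum>n<N. cnj (sgn (\<gamma> n)) * \<gamma> n)"
      by (simp add: cnj_sgn_mult sum_nonneg flip: of_real_sum)
    also have "\<dots> \<le> lp_norm p (restrict_seq {..<N} (\<lambda>n. cnj (sgn (\<gamma> n))))"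
      by (rule bound)
    also have "\<dots> \<le> 1"
      unfolding infinity by (rule lp_norm_restrict_seq_infinity_le) (auto simp: norm_sgn)
    finally show ?thesis .
  qed
  then have "summable (\<lambda>n. cmod (\<gamma> n))"
    by (intro summableI_nonneg_bounded) auto
  with le show ?thesis
    unfolding coeff_ball_def infinity(2) by (simp add: lp_seqs_1 lp_norm_1 suminf_le_const)
next
  case (real r s)
  have rs: "(s - 1) * r = s"
    using real by (simp add: field_simps)
  have le: "(\<Sum>n<N. cmod (\<gamma> n) powr s) \<le> 1" for N
  proof -
    let ?S = "\<Sum>n<N. cmod (\<gamma> n) powr s"
    \<comment> \<open>The case of equality in Hoelder's inequality: both
      \<open>c n * \<gamma> n\<close> and \<open>cmod (c n) powr r\<close> equal
      \<open>cmod (\<gamma> n) powr s\<close>, the latter since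
      \<open>(s - 1) * r = s\<close>.\<close>
    define c where "c n = cnj (sgn (\<gamma> n)) * complex_of_real (cmod (\<gamma> n) powr (s - 1))" for n
    have "c n * \<gamma> n = complex_of_real (cmod (\<gamma> n) powr s)" for n
    proof -
      have "c n * \<gamma> n = cmod (\<gamma> n) powr (s - 1) * complex_of_real (cmod (\<gamma> n))"
        using cnj_sgn_mult[of "\<gamma> n"] by (simp add: c_def mult_ac)
      also have "\<dots> = complex_of_real (cmod (\<gamma> n) powr (s - 1) * cmod (\<gamma> n) powr 1)"
        by simp
      also have "\<dots> = complex_of_real (cmod (\<gamma> n) powr s)"
        by (subst powr_add[symmetric]) simp
      finally show ?thesis .
    qed
    then have "?S = cmod (\<Sum>n<N. c n * \<gamma> n)"
      by (simp add: sum_nonneg flip: of_real_sum)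
    also have "\<dots> \<le> lp_norm p (restrict_seq {..<N} c)"
      by (rule bound)
    also have "\<dots> = (\<Sum>n<N. cmod (c n) powr r) powr (1 / r)"
      by (simp add: real lp_norm_restrict_seq_ereal)
    also have "(\<lambda>n. cmod (c n) powr r) = (\<lambda>n. cmod (\<gamma> n) powr s)"
      using rs by (auto simp: fun_eq_iff c_def norm_mult norm_sgn powr_powr)
    finally have S: "?S \<le> ?S powr (1 / r)" .
    show ?thesis
    proof (rule ccontr)
      assume "\<not> ?S \<le> 1"
      then have "1 < ?S" by simp
      \<comment> \<open>As \<open>1 / r < 1\<close>, a number greater than 1 strictly exceeds this
        power of itself, against \<open>S\<close>.\<close>
      then have "?S powr (1 / r) < ?S powr 1"
        using real by (intro powr_less_mono) auto
      with S \<open>1 < ?S\<close> show False by simp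
    qed
  qed
  then have summable: "summable (\<lambda>n. cmod (\<gamma> n) powr s)"
    by (intro summableI_nonneg_bounded) auto
  moreover have "(\<Sum>n. cmod (\<gamma> n) powr s) powr (1 / s) \<le> 1 powr (1 / s)"
    using summable le real by (intro powr_mono2 suminf_le_const suminf_nonneg) auto
  ultimately show ?thesis
    unfolding coeff_ball_def real(2) by (simp add: lp_seqs_ereal lp_norm_ereal)
qed (use assms in simp)

text \<open>Weights of the order of the inverse square root of the tail suffice:
  \<open>g n / (sqrt (R n) + sqrt (R (Suc n)))\<close> is a difference of consecutive square roots
  and telescopes, while the denominators tend to 0.\<close>

lemma summable_weight:
  fixes f :: "nat \<Rightarrow> real"
  assumes f: "summable f" "\<And>n. 0 \<le> f n" and "0 < e"
  obtains w where "\<And>n. 1 \<le> w n" "(\<lambda>n. inverse (w n)) \<longlonglongrightarrow> 0"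
    "summable (\<lambda>n. w n * f n)" "(\<Sum>n. w n * f n) \<le> (\<Sum>n. f n) + e"
proof -
  \<comment> \<open>The geometric term keeps every tail \<open>R n\<close> strictly positive, even
    if \<open>f\<close> ends in zeros, so that no \<open>D n\<close> vanishes.\<close>
  define g where "g n = f n + (1 / 2) ^ n" for n
  have g: "summable g"
    unfolding g_def using f(1) by (intro summable_add summable_geometric) auto
  have g_pos: "0 < g n" for n
    using f(2) by (simp add: g_def add_nonneg_pos)
  define R where "R n = suminf g - sum g {..<n}" for n
  have R_pos: "0 < R n" for n
    using sum_less_suminf[OF g] g_pos by (simp add: R_def)
  have R_diff: "R n - R (Suc n) = g n" for n
    by (simp add: R_def)
  have R_lim: "R \<longlonglongrightarrow> 0"
    using tendsto_diff[OF tendsto_const summable_LIMSEQ[OF g], of "suminf g"]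
    unfolding R_def by simp
  define D where "D n = sqrt (R n) + sqrt (R (Suc n))" for n
  have D_pos: "0 < D n" for n
    using R_pos by (simp add: D_def add_pos_pos)
  have D_lim: "D \<longlonglongrightarrow> 0"
    unfolding D_def
    using tendsto_add[OF tendsto_real_sqrt[OF R_lim] tendsto_real_sqrt[OF LIMSEQ_Suc[OF R_lim]]]
    by simp
  have g_D: "g n / D n = sqrt (R n) - sqrt (R (Suc n))" for n
  proof -
    have "(sqrt (R n) - sqrt (R (Suc n))) * D n = g n"
      using R_pos[of n] R_pos[of "Suc n"] R_diff[of n] by (simp add: D_def algebra_simps)
    then show ?thesis using D_pos[of n] by (simp add: field_simps)
  qed
  \<comment> \<open>The telescoped sum is at most \<open>sqrt (R 0)\<close>, so this
    \<open>d\<close> limits the total increase to \<open>e\<close>.\<close>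
  define d where "d = e / sqrt (R 0)"
  have d: "0 < d" using \<open>0 < e\<close> R_pos by (simp add: d_def)
  define w where "w n = 1 + d / D n" for n
  have w1: "1 \<le> w n" for n using d D_pos[of n] by (simp add: w_def)
  have w_pos: "0 < w n" for n using w1[of n] by simp
  have w_lim: "(\<lambda>n. inverse (w n)) \<longlonglongrightarrow> 0"
  proof (rule tendsto_sandwich)
    show "\<forall>\<^sub>F n in sequentially. inverse (w n) \<le> D n / d"
    proof (intro always_eventually allI)
      fix n
      have "inverse (w n) \<le> inverse (d / D n)"
        using d D_pos[of n] by (intro le_imp_inverse_le) (auto simp: w_def)
      then show "inverse (w n) \<le> D n / d" by simp
    qed
    show "\<forall>\<^sub>F n in sequentially. 0 \<le> inverse (w n)"
      using w_pos by (intro always_eventually) (simp add: less_imp_le)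
    show "(\<lambda>n. D n / d) \<longlonglongrightarrow> 0"
      using tendsto_divide[OF D_lim tendsto_const, of d] d by simp
  qed simp
  have sum_le: "(\<Sum>n<N. w n * f n) \<le> suminf f + e" for N
  proof -
    have "(\<Sum>n<N. w n * f n) \<le> (\<Sum>n<N. f n + d * (sqrt (R n) - sqrt (R (Suc n))))"
    proof (rule sum_mono)
      fix n
      have "d * (f n / D n) \<le> d * (g n / D n)"
        using d D_pos[of n] by (intro mult_left_mono divide_right_mono) (auto simp: g_def)
      then show "w n * f n \<le> f n + d * (sqrt (R n) - sqrt (R (Suc n)))"
        unfolding g_D by (simp add: w_def algebra_simps)
    qed
    also have "\<dots> = (\<Sum>n<N. f n) + d * (sqrt (R 0) - sqrt (R N))"
      by (simp add: sum.distrib sum_distrib_left[symmetric] sum_lessThan_telescope'[of "\<lambda>n. sqrt (R n)"])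
    also have "\<dots> \<le> suminf f + d * sqrt (R 0)"
      using d R_pos[of N] f by (intro add_mono sum_le_suminf mult_left_mono) auto
    also have "d * sqrt (R 0) = e"
      using R_pos[of 0] by (simp add: d_def)
    finally show ?thesis .
  qed
  have "summable (\<lambda>n. w n * f n)"
    using sum_le f(2) w1 by (intro summableI_nonneg_bounded) (auto simp: less_imp_le[OF w_pos])
  then show thesis
    using that[of w] w1 w_lim suminf_le_const sum_le by blast
qed

section \<open>Extension of the operator\<close>

lemma bounded_linear_cblinfun_eval: "bounded_linear (\<lambda>f. cblinfun_apply f x)"
  by (rule bounded_linear_intro[where K = "norm x"])
    (auto simp: plus_cblinfun.rep_eq scaleR_cblinfun.rep_eq norm_cblinfun)

lemma bounded_linear_bcontfun_eval:
  "bounded_linear (\<lambda>f :: 'i :: topological_space \<Rightarrow>\<^sub>C 'b :: real_normed_vector. apply_bcontfun f i)"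
  by (rule bounded_linear_intro[where K = 1]) (auto simp: norm_bounded)

text \<open>Continuity in \<open>S\<close> allows a functional to be composed with an operator
  series term by term, which computes the adjoint of the extension.\<close>

lemma bounded_linear_cblinfun_compose_right:
  "bounded_linear (\<lambda>S. cblinfun_compose R S)"
proof (rule bounded_linear_intro[where K = "norm R"])
  interpret R: linear "cblinfun_apply R" by (rule cblinfun_linear)
  show "cblinfun_compose R (S + S') = cblinfun_compose R S + cblinfun_compose R S'" for S S'
    by (rule cblinfun_eqI) (simp add: cblinfun_compose.rep_eq plus_cblinfun.rep_eq R.add)
  show "cblinfun_compose R (t *\<^sub>R S) = t *\<^sub>R cblinfun_compose R S" for t S
    by (rule cblinfun_eqI) (simp add: cblinfun_compose.rep_eq scaleR_cblinfun.rep_eq R.scaleR)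
  show "norm (cblinfun_compose R S) \<le> norm S * norm R" for S
    using norm_cblinfun_compose[of R S] by (simp add: mult.commute)
qed

lemma bounded_linear_scaleC_left: "bounded_linear (\<lambda>c. c *\<^sub>C x)"
proof (rule bounded_linear_intro[where K = "norm x"])
  show "(r *\<^sub>R c) *\<^sub>C x = r *\<^sub>R c *\<^sub>C x" for r c
    by (metis scaleC_of_real scaleC_scaleC scaleR_conv_of_real)
qed (auto simp: scaleC_add_left norm_scaleC)

lift_definition rank_one ::
    "'z :: complex_normed_vector cdual \<Rightarrow> 'w :: complex_normed_vector \<Rightarrow> 'z \<Rightarrow>\<^sub>B 'w"
  is "\<lambda>f w x. cblinfun_apply f x *\<^sub>C w"
proof -
  fix f :: "'z cdual" and w :: 'w
  have "bounded_linear (\<lambda>x. f x *\<^sub>C w)"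
    by (rule bounded_linear_compose[OF bounded_linear_scaleC_left bounded_linear_apply])
  then show "bounded_clinear (\<lambda>x. f x *\<^sub>C w)"
    by (simp add: bounded_clinear_def cblinfun_scaleC scaleC_complex_def scaleC_scaleC)
qed

lemma cblinfun_compose_rank_one: "cblinfun_compose \<mu> (rank_one f w) = \<mu> w *\<^sub>C f"
  for \<mu> :: "'w :: complex_normed_vector cdual"
  by (rule cblinfun_eqI)
    (simp add: cblinfun_compose.rep_eq rank_one.rep_eq scaleC_cblinfun.rep_eq cblinfun_scaleC
      scaleC_complex_def)

section \<open>Series of rank-one operators with pointwise given coefficients\<close>

locale coefficient_functions =
  fixes p :: ereal and a :: "nat \<Rightarrow> 'i :: metric_space \<Rightarrow>\<^sub>C complex"
  assumes p: "1 \<le> p" and coeff: "\<And>i. (\<lambda>n. apply_bcontfun (a n) i) \<in> coeff_ball p"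
begin

text \<open>The target carries a supremum norm, so Hoelder's inequality at each single point
  \<open>i\<close> bounds the whole operator.\<close>

lemma norm_sum_rank_one_le:
  fixes f :: "nat \<Rightarrow> 'z :: complex_normed_vector cdual"
  assumes "finite F"
  shows "norm (\<Sum>n\<in>F. rank_one (f n) (a n)) \<le> lp_norm p (restrict_seq F f)"
proof (rule norm_cblinfun_bound)
  fix x
  let ?N = "lp_norm p (restrict_seq F f)"
  show "norm (cblinfun_apply (\<Sum>n\<in>F. rank_one (f n) (a n)) x) \<le> ?N * norm x"
  proof (rule norm_bound)
    fix i
    have "apply_bcontfun (cblinfun_apply (\<Sum>n\<in>F. rank_one (f n) (a n)) x) i
        = (\<Sum>n\<in>F. f n x * apply_bcontfun (a n) i)"
      by (simp add: linear_sum[OF bounded_linear.linear[OF bounded_linear_cblinfun_eval]]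
          linear_sum[OF bounded_linear.linear[OF bounded_linear_bcontfun_eval]] rank_one.rep_eq
          scaleC_complex_def)
    also have "norm \<dots> \<le> (\<Sum>n\<in>F. cmod (apply_bcontfun (a n) i) * norm (restrict_seq F f n)) * norm x"
      unfolding sum_distrib_right
    proof (rule sum_norm_le)
      fix n assume "n \<in> F"
      then show "cmod (f n x * apply_bcontfun (a n) i)
          \<le> cmod (apply_bcontfun (a n) i) * norm (restrict_seq F f n) * norm x"
        using mult_left_mono[OF norm_cblinfun[of "f n" x], of "cmod (apply_bcontfun (a n) i)"]
        by (simp add: restrict_seq_def norm_mult mult_ac)
    qed
    also have "\<dots> \<le> ?N * norm x"
      by (intro mult_right_mono lp_holder p coeff restrict_seq_lp_seqs assms) simp
    finally show "norm (apply_bcontfun (cblinfun_apply (\<Sum>n\<in>F. rank_one (f n) (a n)) x) i) \<le> ?N * norm x" .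
  qed
qed (use assms in \<open>intro lp_norm_nonneg restrict_seq_lp_seqs\<close>)

text \<open>For \<open>p > 1\<close> the norms of the terms need not be summable. Instead, a block
  of the series is bounded by the norm of the same block of \<open>f\<close>, which tends to
  0.\<close>

lemma summable_rank_one:
  fixes f :: "nat \<Rightarrow> 'z :: complex_normed_vector cdual"
  assumes "f \<in> lp_seqs p"
  shows "summable (\<lambda>n. rank_one (f n) (a n))"
  unfolding summable_Cauchy
proof (intro allI impI)
  fix e :: real assume "0 < e"
  then obtain N where N: "\<And>m n. N \<le> m \<Longrightarrow> lp_norm p (restrict_seq {m..<n} f) \<le> e / 2"
    using lp_norm_tail[OF p assms, of "e / 2"] by auto
  have "norm (\<Sum>k=m..<n. rank_one (f k) (a k)) < e" if "N \<le> m" for m n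
    using norm_sum_rank_one_le[of "{m..<n}" f] N[OF that, of n] \<open>0 < e\<close> by simp
  then show "\<exists>N. \<forall>m\<ge>N. \<forall>n. norm (\<Sum>k=m..<n. rank_one (f k) (a k)) < e" by blast
qed

lemma norm_sum_scaleC_le:
  assumes "finite F"
  shows "norm (\<Sum>n\<in>F. c n *\<^sub>C a n) \<le> lp_norm p (restrict_seq F c)"
proof (rule norm_bound)
  fix i
  have "apply_bcontfun (\<Sum>n\<in>F. c n *\<^sub>C a n) i = (\<Sum>n\<in>F. c n * apply_bcontfun (a n) i)"
    by (simp add: linear_sum[OF bounded_linear.linear[OF bounded_linear_bcontfun_eval]]
        scaleC_complex_def)
  also have "norm \<dots> \<le> (\<Sum>n\<in>F. cmod (apply_bcontfun (a n) i) * norm (restrict_seq F c n))"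
    by (rule sum_norm_le) (simp add: restrict_seq_def norm_mult mult_ac)
  also have "\<dots> \<le> lp_norm p (restrict_seq F c)"
    by (intro lp_holder p coeff restrict_seq_lp_seqs assms)
  finally show "norm (apply_bcontfun (\<Sum>n\<in>F. c n *\<^sub>C a n) i) \<le> lp_norm p (restrict_seq F c)" .
qed

text \<open>A functional of norm at most 1 preserves the bound on combinations of the
  \<open>a n\<close>. For \<open>F = {..<N}\<close> this is the premise of
  \<open>coeff_ballI_dual\<close> for the coefficients \<open>\<mu> (a n)\<close> of the
  adjoint.\<close>

lemma dual_coefficients:
  fixes \<mu> :: "('i \<Rightarrow>\<^sub>C complex) cdual"
  assumes "norm \<mu> \<le> 1" "finite F"
  shows "cmod (\<Sum>n\<in>F. c n * \<mu> (a n)) \<le> lp_norm p (restrict_seq F c)"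
proof -
  have "(\<Sum>n\<in>F. c n * \<mu> (a n)) = \<mu> (\<Sum>n\<in>F. c n *\<^sub>C a n)"
    by (simp add: linear_sum[OF cblinfun_linear] cblinfun_scaleC scaleC_complex_def)
  also have "cmod \<dots> \<le> norm \<mu> * norm (\<Sum>n\<in>F. c n *\<^sub>C a n)"
    by (rule norm_cblinfun)
  also have "\<dots> \<le> norm (\<Sum>n\<in>F. c n *\<^sub>C a n)"
    using assms by (intro mult_left_le_one_le) auto
  also have "\<dots> \<le> lp_norm p (restrict_seq F c)"
    by (rule norm_sum_scaleC_le[OF assms(2)])
  finally show ?thesis .
qed

lemma dual_coefficient_le_1:
  fixes \<mu> :: "('i \<Rightarrow>\<^sub>C complex) cdual"
  assumes "norm \<mu> \<le> 1"
  shows "cmod (\<mu> (a k)) \<le> 1"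
  using dual_coefficients[OF assms, of "{k}" "\<lambda>_. 1"]
    lp_norm_restrict_seq_singleton_le[OF p, of k] by simp

text \<open>The adjoint sends \<open>\<mu>\<close> to the series of
  \<open>\<mu> (a n) *\<^sub>C f n\<close>, so \<open>f\<close> itself is a witness when
  \<open>p\<close> differs from 1. For \<open>p = 1\<close> the slack \<open>e\<close> pays for the
  weights.\<close>

lemma p_compact_witness_adjoint:
  fixes f :: "nat \<Rightarrow> 'z :: complex_banach cdual"
  assumes f: "f \<in> lp_seqs p" and "0 < e"
  obtains v where "v \<in> p_compact_witnesses p (adjoint (\<Sum>n. rank_one (f n) (a n)))"
    "lp_norm p v \<le> lp_norm p f + e"
proof -
  let ?S = "\<Sum>n. rank_one (f n) (a n)"
  have adj: "adjoint ?S \<mu> = synthesis f (\<lambda>n. \<mu> (a n))" for \<mu> :: "('i \<Rightarrow>\<^sub>C complex) cdual"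
    using bounded_linear.suminf[OF bounded_linear_cblinfun_compose_right[of \<mu>] summable_rank_one[OF f]]
    by (simp add: adjoint.rep_eq synthesis_def cblinfun_compose_rank_one)
  show thesis
  proof (cases "p = 1")
    case False
    have "(\<lambda>n. \<mu> (a n)) \<in> coeff_ball p" if "norm \<mu> \<le> 1" for \<mu> :: "('i \<Rightarrow>\<^sub>C complex) cdual"
      using p False dual_coefficients[OF that finite_lessThan] by (rule coeff_ballI_dual)
    then have "f \<in> p_compact_witnesses p (adjoint ?S)"
      using f by (auto simp: p_compact_witnesses_def adj)
    then show thesis using that \<open>0 < e\<close> by force
  next
    case True
    txt \<open>The coefficients \<open>\<mu> (a n)\<close> are only bounded, so they are made into a null sequence
      at the expense of the functionals \<open>f n\<close>.\<close>
    obtain w where w: "\<And>n. 1 \<le> w n" "(\<lambda>n. inverse (w n)) \<longlonglongrightarrow> 0"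
        "summable (\<lambda>n. w n * norm (f n))" "(\<Sum>n. w n * norm (f n)) \<le> (\<Sum>n. norm (f n)) + e"
      using summable_weight[of "\<lambda>n. norm (f n)" e] f True \<open>0 < e\<close> by (auto simp: lp_seqs_1)
    have w0: "0 < w n" for n using w(1)[of n] by simp
    define v where "v n = w n *\<^sub>R f n" for n
    have norm_v: "norm (v n) = w n * norm (f n)" for n
      using w0[of n] by (simp add: v_def)
    have v: "v \<in> lp_seqs 1" using w(3) by (simp add: lp_seqs_1 norm_v)
    have "adjoint ?S \<mu> \<in> synthesis v ` coeff_ball p" if "norm \<mu> \<le> 1"
      for \<mu> :: "('i \<Rightarrow>\<^sub>C complex) cdual"
    proof
      \<comment> \<open>Dividing the coefficients by the weights that multiply \<open>f\<close>
        leaves the series unchanged; as \<open>\<mu> (a n)\<close> is bounded by 1 and the weights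
        tend to infinity, the quotients form a null sequence.\<close>
      let ?b = "\<lambda>n. complex_of_real (inverse (w n)) * \<mu> (a n)"
      have le: "cmod (?b n) \<le> inverse (w n)" for n
        using dual_coefficient_le_1[OF that, of n] w0[of n]
        by (simp add: norm_mult norm_inverse mult_left_le)
      have "inverse (w n) \<le> 1" for n using w(1)[of n] by (simp add: inverse_le_1_iff)
      then have "cmod (?b n) \<le> 1" for n using le order_trans by blast
      moreover have "?b \<longlonglongrightarrow> 0"
        by (rule Lim_null_comparison[OF _ w(2)]) (use le in auto)
      ultimately show "?b \<in> coeff_ball p"
        by (auto simp: coeff_ball_def True conjugate_exponent_def lp_seqs_infinity lp_norm_infinity
            intro: cSUP_least)
      have "?b n *\<^sub>C v n = \<mu> (a n) *\<^sub>C f n" for n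
      proof -
        have "?b n * complex_of_real (w n) = \<mu> (a n)"
          using w0[of n] by (simp add: field_simps)
        then show ?thesis
          by (simp only: v_def scaleC_of_real[symmetric] scaleC_scaleC)
      qed
      then show "adjoint ?S \<mu> = synthesis v ?b"
        by (simp add: adj synthesis_def)
    qed
    then have "v \<in> p_compact_witnesses p (adjoint ?S)"
      using v True by (auto simp: p_compact_witnesses_def)
    moreover have "lp_norm p v \<le> lp_norm p f + e"
      using v f w(4) True by (simp add: lp_norm_1 norm_v)
    ultimately show thesis by (rule that)
  qed
qed

end

section \<open>Extension of operators with p-compact adjoint\<close>

theorem theorem3p4:
  fixes p :: ereal
    and T :: "'x :: complex_banach \<Rightarrow>\<^sub>B 'y :: complex_banach"
    and J :: "'x \<Rightarrow>\<^sub>B 'z :: complex_banach"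
    and \<epsilon> :: real
  assumes "1 \<le> p"
    and "T \<in> dual_p_compact p"
    and "\<epsilon> > 0"
    and "\<And>x. norm (J x) = norm x" (* J realises the inclusion of X in Z *)
  shows "\<exists>T' :: 'z \<Rightarrow>\<^sub>B 'y dual_ball_linf.
           T' \<in> dual_p_compact p \<and>
           (\<forall>x. T' (J x) = canonical_embedding (T x)) \<and>
           dual_p_compact_norm p T' \<le> dual_p_compact_norm p T + \<epsilon>"
proof -
  let ?W = "p_compact_witnesses p (adjoint T)"
  have ne: "?W \<noteq> {}"
    using assms(2) by (simp add: dual_p_compact_def p_compact_def)
  have bdd: "bdd_below (lp_norm p ` p_compact_witnesses p S)"
    for S :: "'u :: complex_banach \<Rightarrow>\<^sub>B 'v :: complex_banach"
    by (rule bdd_belowI2[where m = 0]) (auto simp: p_compact_witnesses_def lp_norm_nonneg)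
  \<comment> \<open>Half of \<open>\<epsilon>\<close> is spent on a nearly optimal witness
    \<open>v\<close>; the other half is left for the passage from \<open>f\<close> to
    \<open>u\<close>.\<close>
  obtain v where v: "v \<in> ?W" "lp_norm p v < dual_p_compact_norm p T + \<epsilon> / 2"
    using cINF_less_iff[OF ne bdd, of "dual_p_compact_norm p T + \<epsilon> / 2"] \<open>\<epsilon> > 0\<close>
    by (auto simp: dual_p_compact_norm_def p_compact_norm_def)
  have "\<exists>g :: 'z cdual. (\<forall>x. cblinfun_apply g (J x) = cblinfun_apply (v n) x) \<and> norm g = norm (v n)" for n
    using hahn_banach_complex[of J "v n"] assms(4) by metis
  then obtain f :: "nat \<Rightarrow> 'z cdual" where f: "\<And>n x. cblinfun_apply (f n) (J x) = cblinfun_apply (v n) x"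
      "\<And>n. norm (f n) = norm (v n)"
    by metis
  have v_lp: "v \<in> lp_seqs p"
    using v(1) by (simp add: p_compact_witnesses_def)
  have f_lp: "f \<in> lp_seqs p" "lp_norm p f = lp_norm p v"
    using v_lp lp_cong[of f v p] f(2) by auto
  have "\<exists>\<alpha>\<in>coeff_ball p. adjoint T (dual_ball_functional \<phi>) = synthesis v \<alpha>" for \<phi>
  proof -
    have "dual_ball_functional \<phi> \<in> cball 0 1"
      using dual_ball_functional[of \<phi>] by simp
    then have "adjoint T (dual_ball_functional \<phi>) \<in> synthesis v ` coeff_ball p"
      using v(1) unfolding p_compact_witnesses_def by blast
    then show ?thesis by blast
  qed
  then obtain \<alpha> where \<alpha>: "\<And>\<phi>. \<alpha> \<phi> \<in> coeff_ball p"
      "\<And>\<phi>. adjoint T (dual_ball_functional \<phi>) = synthesis v (\<alpha> \<phi>)"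
    by metis
  \<comment> \<open>The choice of \<open>\<alpha> \<phi>\<close> need be neither linear nor
    continuous in \<open>\<phi>\<close>: on the discrete dual ball, boundedness alone puts
    \<open>a n\<close> into the target space.\<close>
  define a :: "nat \<Rightarrow> 'y dual_ball_linf" where "a n = Bcontfun (\<lambda>\<phi>. \<alpha> (of_discrete \<phi>) n)" for n
  have a: "apply_bcontfun (a n) \<phi> = \<alpha> (of_discrete \<phi>) n" for n \<phi>
  proof -
    have "(\<lambda>\<phi>. \<alpha> (of_discrete \<phi>) n) \<in> bcontfun"
      using coeff_ball_le_1[OF assms(1) \<alpha>(1)]
      by (intro bcontfun_normI[where b = 1]) (auto simp: continuous_on_open_vimage open_discrete)
    then show ?thesis by (simp add: a_def Bcontfun_inverse)
  qed
  interpret coefficient_functions p a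
    by standard (simp_all add: a \<alpha>(1) assms(1))
  define T' where "T' = (\<Sum>n. rank_one (f n) (a n))"
  obtain u where u: "u \<in> p_compact_witnesses p (adjoint T')" "lp_norm p u \<le> lp_norm p f + \<epsilon> / 2"
    using p_compact_witness_adjoint[OF f_lp(1), of "\<epsilon> / 2"] \<open>\<epsilon> > 0\<close> unfolding T'_def by auto
  have "apply_bcontfun (T' (J x)) \<phi> = apply_bcontfun (canonical_embedding (T x)) \<phi>" for x \<phi>
  proof -
    \<comment> \<open>Evaluation at \<open>J x\<close> and then at \<open>\<phi>\<close> is
      continuous in the operator, so it passes through the series.\<close>
    have eval: "bounded_linear (\<lambda>S. apply_bcontfun (cblinfun_apply S (J x)) \<phi>)"
      by (rule bounded_linear_compose[OF bounded_linear_bcontfun_eval bounded_linear_cblinfun_eval])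
    have "apply_bcontfun (T' (J x)) \<phi> = (\<Sum>n. cblinfun_apply (v n) x * \<alpha> (of_discrete \<phi>) n)"
      unfolding T'_def bounded_linear.suminf[OF eval summable_rank_one[OF f_lp(1)]]
      by (simp add: rank_one.rep_eq f(1) a scaleC_complex_def)
    \<comment> \<open>The values at \<open>\<phi>\<close> of the \<open>a n\<close> are the
      coefficients representing the adjoint of \<open>T\<close> at \<open>\<phi>\<close>, so the
      series returns \<open>\<phi> (T x)\<close> on the copy of \<open>X\<close>.\<close>
    also have "\<dots> = adjoint T (dual_ball_functional (of_discrete \<phi>)) x"
      using bounded_linear.suminf[OF bounded_linear_cblinfun_eval[of x]
          summable_synthesis[OF assms(1) \<alpha>(1) v_lp]]
      by (simp add: \<alpha>(2) synthesis_def scaleC_cblinfun.rep_eq scaleC_complex_def mult.commute)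
    also have "\<dots> = apply_bcontfun (canonical_embedding (T x)) \<phi>"
      by (simp add: adjoint_apply apply_canonical_embedding)
    finally show ?thesis .
  qed
  then have "T' (J x) = canonical_embedding (T x)" for x
    by (rule bcontfun_eqI)
  moreover have "T' \<in> dual_p_compact p"
    using u(1) by (auto simp: dual_p_compact_def p_compact_def)
  moreover have "dual_p_compact_norm p T' \<le> lp_norm p u"
    unfolding dual_p_compact_norm_def p_compact_norm_def by (rule cINF_lower[OF bdd u(1)])
  ultimately show ?thesis
    using u(2) v(2) f_lp(2) by (intro exI[of _ T']) auto
qed

end
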